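(* Let $q$ be a prime power and $n$ a positive integer with $\gcd(n,q)=1$. Let $\gamma\in\mathbb{Z}/n\mathbb{Z}$ and $n_\gamma=n/\gcd(\gamma,n)$. Then the $q$-cyclotomic coset $c_{n/q}(\gamma)$ is of equal difference if and only if both of the following hold: (i) $\mathrm{rad}(n_\gamma)\mid q-1$; (ii) if $8\mid n_\gamma$, then $q\equiv 1\pmod 4$.
   Context: For $\gamma\in\mathbb{Z}/n\mathbb{Z}$ (with $\gcd(n,q)=1$), the $q$-cyclotomic coset modulo $n$ containing $\gamma$ is $c_{n/q}(\gamma)=\{\gamma,\gamma q,\dots,\gamma q^{\tau-1}\}\subseteq\mathbb{Z}/n\mathbb{Z}$, where the size $\tau=|c_{n/q}(\gamma)|$ is the least positive integer with $\gamma q^\tau\equiv\gamma\pmod n$. The coset is called of equal difference (an equal-difference coset) if $\tau\mid n$ and $c_{n/q}(\gamma)=\{\gamma,\gamma+\frac n\tau,\dots,\gamma+(\tau-1)\frac n\tau\}$ in $\mathbb{Z}/n\mathbb{Z}$; a coset with one element is regarded as of equal difference. Here $\gcd(\gamma,n)$ is computed for any integer representative of $\gamma$ (with $\gcd(0,n)=n$), and $\mathrm{rad}(m)$ denotes the product of the distinct primes dividing $m$ ($\mathrm{rad}(1)=1$). *)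

theory Defs
  imports "HOL-Number_Theory.Number_Theory"
begin

text \<open>
  An element of \<open>\<int>/n\<int>\<close> is given by an arbitrary integer representative \<open>\<gamma>\<close>; subsets of \<open>\<int>/n\<int>\<close>
  are sets of canonical representatives in \<open>{0..<n}\<close>, obtained with \<open>mod\<close>.
\<close>

definition coset_size :: "nat \<Rightarrow> nat \<Rightarrow> int \<Rightarrow> nat" where
  "coset_size n q \<gamma> = (LEAST t. 0 < t \<and> [\<gamma> * int q ^ t = \<gamma>] (mod int n))"

definition cyclotomic_coset :: "nat \<Rightarrow> nat \<Rightarrow> int \<Rightarrow> int set" where
  "cyclotomic_coset n q \<gamma> = (\<lambda>i. (\<gamma> * int q ^ i) mod int n) ` {..<coset_size n q \<gamma>}"

text \<open>
  Cosets with one element need no separate clause: see \<open>equal_difference_if_size_one\<close> below.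
\<close>

definition equal_difference :: "nat \<Rightarrow> nat \<Rightarrow> int \<Rightarrow> bool" where
  "equal_difference n q \<gamma> \<longleftrightarrow>
     (let \<tau> = coset_size n q \<gamma> in
        \<tau> dvd n \<and>
        cyclotomic_coset n q \<gamma> = (\<lambda>i. (\<gamma> + int i * int (n div \<tau>)) mod int n) ` {..<\<tau>})"

definition rad :: "nat \<Rightarrow> nat" where
  "rad m = \<Prod>(prime_factors m)"

definition reduced_modulus :: "nat \<Rightarrow> int \<Rightarrow> nat" where
  "reduced_modulus n \<gamma> = n div nat (gcd \<gamma> (int n))"

lemma coset_size_props:
  assumes "coprime n q"
  shows "0 < coset_size n q \<gamma>" "[\<gamma> * int q ^ coset_size n q \<gamma> = \<gamma>] (mod int n)"
proof -
  have "\<exists>t. 0 < t \<and> [\<gamma> * int q ^ t = \<gamma>] (mod int n)"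
  proof (cases "n = 0")
    case True
    then have "q = 1" using assms by simp
    then show ?thesis by (intro exI[of _ 1]) simp
  next
    case False
    have "[q ^ totient n = 1] (mod n)"
      using assms by (intro euler_theorem) (simp add: coprime_commute)
    then have "[int q ^ totient n = 1] (mod int n)"
      by (metis cong_int_iff of_nat_1 of_nat_power)
    then have "[\<gamma> * int q ^ totient n = \<gamma> * 1] (mod int n)"
      by (rule cong_scalar_left)
    then show ?thesis using False by (intro exI[of _ "totient n"]) simp
  qed
  then have "0 < coset_size n q \<gamma> \<and> [\<gamma> * int q ^ coset_size n q \<gamma> = \<gamma>] (mod int n)"
    unfolding coset_size_def by (rule LeastI_ex)
  then show "0 < coset_size n q \<gamma>" "[\<gamma> * int q ^ coset_size n q \<gamma> = \<gamma>] (mod int n)"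
    by auto
qed

lemma card_cyclotomic_coset:
  assumes "coprime n q"
  shows "card (cyclotomic_coset n q \<gamma>) = coset_size n q \<gamma>"
proof -
  have aux: False
    if "i < j" "j < coset_size n q \<gamma>" "(\<gamma> * int q ^ i) mod int n = (\<gamma> * int q ^ j) mod int n" for i j
  proof -
    have "[\<gamma> * int q ^ (j - i) * int q ^ i = \<gamma> * int q ^ i] (mod int n)"
      using that by (simp add: cong_def mult.assoc flip: power_add)
    moreover have "coprime (int q ^ i) (int n)"
      using assms by (simp add: coprime_commute)
    ultimately have "[\<gamma> * int q ^ (j - i) = \<gamma>] (mod int n)"
      by (simp add: cong_mult_rcancel)
    then have "coset_size n q \<gamma> \<le> j - i"
      unfolding coset_size_def using that by (intro Least_le) auto
    then show False using that by linarith
  qed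
  have "inj_on (\<lambda>i. (\<gamma> * int q ^ i) mod int n) {..<coset_size n q \<gamma>}"
    by (rule inj_onI) (metis aux lessThan_iff nat_neq_iff)
  then show ?thesis
    by (simp add: cyclotomic_coset_def card_image)
qed

lemma equal_difference_if_size_one:
  "coset_size n q \<gamma> = 1 \<Longrightarrow> equal_difference n q \<gamma>"
  by (simp add: equal_difference_def cyclotomic_coset_def)

end

theory Submission
  imports Defs
begin

text \<open>
  Dividing by \<open>gcd \<gamma> n\<close> turns the coset into \<open>g\<langle>q\<rangle>\<close> modulo \<open>m = n\<^sub>\<gamma>\<close>
  with \<open>g\<close> a unit, and its size is the order \<open>t\<close> of \<open>q\<close> modulo \<open>m\<close>. Comparing cardinalities,
  the coset is of equal difference iff \<open>t dvd m\<close> and \<open>D = m / t\<close> divides \<open>q - 1\<close>.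

  If this holds, every \<open>1 + i D\<close> is a power of \<open>q\<close> modulo \<open>m\<close>, hence a unit; a prime divisor of \<open>m\<close>
  not dividing \<open>D\<close> would divide one of these, so \<open>rad m dvd D\<close>. If \<open>8 dvd m\<close> but \<open>D\<close> is not divisible
  by \<open>4\<close>, then \<open>1 + 2 D\<close> is congruent to \<open>5\<close> modulo \<open>8\<close> and a power of \<open>q\<close>, which forces
  \<open>q\<close> to be \<open>1\<close> modulo \<open>4\<close>.

  Conversely, \<open>rad m dvd q - 1\<close> gives \<open>m dvd q ^ m - 1\<close>, so \<open>t dvd m\<close>, and lifting the exponent at
  each prime turns \<open>m dvd q ^ t - 1\<close> into \<open>m dvd t * (q - 1)\<close>.
\<close>

section \<open>Radicals and divisibility one prime at a time\<close>

lemma prime_dvd_rad: "prime p \<Longrightarrow> p dvd m \<Longrightarrow> m > 0 \<Longrightarrow> p dvd rad m"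
  unfolding rad_def by (rule dvd_prodI) (auto simp: prime_factors_dvd)

lemma rad_dvdI:
  assumes "\<And>p. prime p \<Longrightarrow> p dvd m \<Longrightarrow> p dvd k"
  shows "rad m dvd k"
  unfolding rad_def
proof -
  have "\<Prod>A dvd k" if "finite A" "A \<subseteq> prime_factors m" for A
    using that
  proof (induction A rule: finite_induct)
    case (insert p A)
    have "coprime p (\<Prod>A)"
      using insert by (intro prod_coprime_right) (auto intro!: primes_coprime)
    then have "p * \<Prod>A dvd k"
      using insert assms by (intro divides_mult) auto
    then show ?case using insert by simp
  qed simp
  then show "\<Prod>(prime_factors m) dvd k" by simp
qed

text \<open>Compares multiplicities prime by prime; this localizes both divisibilities by
  \<open>m\<close> needed for sufficiency.\<close>

lemma dvd_if_prime_powers_dvd: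
  fixes m :: nat and y :: int
  assumes "m > 0" "\<And>p a. prime p \<Longrightarrow> p ^ a dvd m \<Longrightarrow> int p ^ a dvd y"
  shows "int m dvd y"
\<comment> \<open>Zero is split off because its multiplicity at a prime is \<open>0\<close> by
  convention.\<close>
proof (cases "y = 0")
  case False
  have "m dvd nat \<bar>y\<bar>"
  proof (rule multiplicity_le_imp_dvd)
    fix p :: nat assume p: "prime p"
    have "int (p ^ multiplicity p m) dvd y"
      using assms(2)[OF p multiplicity_dvd] by simp
    then have "p ^ multiplicity p m dvd nat \<bar>y\<bar>"
      by (simp only: dvd_nat_abs_iff)
    then show "multiplicity p m \<le> multiplicity p (nat \<bar>y\<bar>)"
      using False p by (intro multiplicity_geI) auto
  qed (use assms in simp)
  then show ?thesis by (simp add: dvd_nat_abs_iff)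
qed simp

section \<open>Equal difference expressed through the order of \<open>q\<close>\<close>

text \<open>The factor \<open>d\<close> cancels from congruence and modulus together, then the unit
  \<open>g\<close> cancels modulo \<open>m\<close>; what remains is the condition minimized by
  \<open>ord\<close>.\<close>

lemma coset_size_eq_ord:
  fixes m q :: nat and g :: int
  assumes "coprime m q" "coprime g (int m)" "d > 0"
  shows "coset_size (d * m) q (int d * g) = ord m q"
proof -
  have "[int d * g * int q ^ t = int d * g] (mod int (d * m)) \<longleftrightarrow> [q ^ t = 1] (mod m)" for t
  proof -
    have "[int d * g * int q ^ t = int d * g] (mod int (d * m)) \<longleftrightarrow> 
        int d * int m dvd int d * (g * int q ^ t - g)"
      by (simp add: cong_iff_dvd_diff algebra_simps)
    also have "\<dots> \<longleftrightarrow> int m dvd g * (int q ^ t - 1)"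
      using assms by (subst dvd_mult_cancel_left) (simp add: right_diff_distrib)
    also have "\<dots> \<longleftrightarrow> int m dvd int q ^ t - 1"
      using assms by (simp add: coprime_commute coprime_dvd_mult_right_iff)
    also have "\<dots> \<longleftrightarrow> [int (q ^ t) = int 1] (mod int m)"
      by (simp add: cong_iff_dvd_diff)
    also have "\<dots> \<longleftrightarrow> [q ^ t = 1] (mod m)"
      by (rule cong_int_iff)
    finally show ?thesis .
  qed
  then show ?thesis
    using assms by (simp add: coset_size_def ord_def)
qed

text \<open>Both sides have \<open>t\<close> elements, so the obvious inclusion suffices.\<close>

lemma cyclotomic_coset_eq_progression:
  fixes m q t D :: nat and g :: int
  assumes "coprime m q" "coprime g (int m)" "m > 0"
    and t: "t = ord m q" "m = t * D" and D: "int D dvd int q - 1"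
  shows "cyclotomic_coset m q g = (\<lambda>i. (g + int i * int D) mod int m) ` {..<t}" (is "_ = ?R")
proof -
  have size: "coset_size m q g = t"
    using coset_size_eq_ord[OF assms(1,2), of 1] t(1) by simp
  have "x \<in> ?R" if x: "x \<in> cyclotomic_coset m q g" for x
  proof -
    obtain j where j: "x = (g * int q ^ j) mod int m"
      using x by (auto simp: cyclotomic_coset_def)
    have "[int q = 1] (mod int D)"
      using D by (simp add: cong_iff_dvd_diff)
    then have "[g * int q ^ j = g * 1 ^ j] (mod int D)"
      by (intro cong_mult cong_pow cong_refl)
    then obtain k where k: "g * int q ^ j = g + int D * k"
      by (auto simp: cong_iff_dvd_diff dvd_def algebra_simps)
    have "t > 0" using assms(3) t(2) by (cases t) auto
    \<comment> \<open>The index may be reduced modulo \<open>t\<close>, since \<open>t\<close> steps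
      of length \<open>D\<close> add up to \<open>m\<close>.\<close>
    define i where "i = nat (k mod int t)"
    have i: "int i = k mod int t" "i < t"
      using \<open>t > 0\<close> by (auto simp: i_def nat_less_iff)
    have "int m dvd int D * (k - k mod int t)"
      unfolding t(2) by (simp add: mult.commute minus_mod_eq_mult_div)
    then have "[g + int D * k = g + int i * int D] (mod int m)"
      by (simp add: cong_iff_dvd_diff i algebra_simps)
    then have "x = (g + int i * int D) mod int m"
      by (simp add: j k cong_def)
    then show ?thesis using i by blast
  qed
  moreover have "card ?R \<le> card (cyclotomic_coset m q g)"
    using card_image_le[of "{..<t}"] assms(1) size by (simp add: card_cyclotomic_coset)
  ultimately show ?thesis
    by (intro card_seteq) auto
qed

text \<open>Scaling by \<open>d\<close> carries the coset of \<open>g\<close> modulo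
  \<open>m\<close> to the coset in question, so one direction is the previous lemma. Conversely, a
  progression of several multiples of \<open>d\<close> has a step divisible by \<open>d\<close>;
  stripping \<open>d\<close> gives \<open>g * q = g\<close> modulo \<open>D\<close>, where the unit
  \<open>g\<close> cancels.\<close>

lemma equal_difference_iff_ord:
  fixes m q d :: nat and g :: int
  assumes "coprime m q" "coprime g (int m)" "m > 0" "d > 0"
  shows "equal_difference (d * m) q (int d * g) \<longleftrightarrow>
    ord m q dvd m \<and> int (m div ord m q) dvd int q - 1"
proof -
  define t where "t = ord m q"
  define E where "E = cyclotomic_coset (d * m) q (int d * g)"
  have size: "coset_size (d * m) q (int d * g) = t" "coset_size m q g = t"
    using coset_size_eq_ord[of m q g d] coset_size_eq_ord[of m q g 1] assms by (auto simp: t_def)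
  have t0: "t > 0"
    using assms by (simp add: t_def coprime_commute)
  have scale: "(int d * x) mod int (d * m) = int d * (x mod int m)" for x
    by simp
  have ed: "equal_difference (d * m) q (int d * g) \<longleftrightarrow> t dvd d * m \<and>
      E = (\<lambda>i. (int d * g + int i * int (d * m div t)) mod int (d * m)) ` {..<t}"
    by (simp only: equal_difference_def Let_def size E_def)
  have E: "E = (\<lambda>x. int d * x) ` cyclotomic_coset m q g"
    unfolding E_def cyclotomic_coset_def size image_image scale[symmetric]
    by (simp add: mult.assoc)
  show ?thesis
    unfolding t_def[symmetric]
  proof
    assume R: "t dvd m \<and> int (m div t) dvd int q - 1"
    have div: "d * m div t = d * (m div t)" using R by (simp add: div_mult_swap)
    have "E = (\<lambda>x. int d * x) ` (\<lambda>i. (g + int i * int (m div t)) mod int m) ` {..<t}"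
      unfolding E using R assms
      by (subst cyclotomic_coset_eq_progression[where t = t and D = "m div t"]) (auto simp: t_def)
    also have "\<dots> = (\<lambda>i. (int d * g + int i * int (d * m div t)) mod int (d * m)) ` {..<t}"
      unfolding image_image scale[symmetric] div by (simp add: algebra_simps)
    finally show "equal_difference (d * m) q (int d * g)"
      using R ed by simp
  next
    assume "equal_difference (d * m) q (int d * g)"
    then have tn: "t dvd d * m"
      and EQ: "E = (\<lambda>i. (int d * g + int i * int (d * m div t)) mod int (d * m)) ` {..<t}"
      using ed by auto
    \<comment> \<open>The case \<open>t = 1\<close> is separate because the general argument uses
      the entries of index 1 on both sides.\<close>
    show "t dvd m \<and> int (m div t) dvd int q - 1"
    proof (cases "t = 1")
      case True
      have "[q ^ t = 1] (mod m)" unfolding t_def by (rule ord)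
      then have "[int q = int 1] (mod int m)" using True by (subst cong_int_iff) simp
      then show ?thesis using True by (simp add: cong_iff_dvd_diff)
    next
      case False
      then have t1: "t > 1" using t0 by simp
      define s where "s = d * m div t"
      have s: "d * m = t * s" using tn by (simp add: s_def)
      have "(int d * g + int 1 * int s) mod int (d * m) \<in> E"
        unfolding EQ s_def using t1 by (intro imageI) auto
      then have "int d dvd (int d * g + int s) mod int (d * m)"
        unfolding E by auto
      then have "int d dvd int d * g + int s"
        by (simp add: dvd_mod_iff)
      then have "d dvd s"
        by (simp add: dvd_add_right_iff)
      then obtain D where D: "s = d * D" by auto
      have mD: "m = t * D" using s assms unfolding D by simp
      have mt: "m div t = D" using mD t0 by simp
      have "(int d * g * int q ^ 1) mod int (d * m) \<in> E"
        unfolding E_def cyclotomic_coset_def size using t1 by (intro imageI) auto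
      then obtain i where "(int d * g * int q) mod int (d * m) = (int d * g + int i * int s) mod int (d * m)"
        unfolding EQ s_def by auto
      then have "(int d * (g * int q)) mod int (d * m) = (int d * (g + int i * int D)) mod int (d * m)"
        by (simp add: D algebra_simps)
      then have "[g * int q = g + int i * int D] (mod int m)"
        unfolding scale cong_def using assms by simp
      \<comment> \<open>Modulo \<open>D\<close> the progression is constant, so the unknown index
        \<open>i\<close> disappears.\<close>
      then have "[g * int q = g + int i * int D] (mod int D)"
        by (rule cong_dvd_modulus) (simp add: mD)
      then have "int D dvd (g * int q - (g + int i * int D)) + int i * int D"
        by (intro dvd_add) (auto simp: cong_iff_dvd_diff)
      then have "int D dvd g * (int q - 1)" by (simp add: algebra_simps)
      moreover have "coprime (int D) g"
        using assms(2) by (simp add: mD coprime_commute)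
      ultimately show ?thesis
        using mD mt by (simp add: coprime_dvd_mult_right_iff)
    qed
  qed
qed

section \<open>Necessity: arithmetic of the numbers \<open>1 + i * D\<close>\<close>

text \<open>The coset of \<open>1\<close> consists of the powers of \<open>q\<close>, so the case
  \<open>g = 1\<close> of the progression gives the exponent.\<close>

lemma power_eq_progression:
  fixes m q t D :: nat
  assumes "coprime m q" "m > 0" "t = ord m q" "m = t * D" "int D dvd int q - 1" "i < t"
  obtains j where "[int q ^ j = 1 + int i * int D] (mod int m)"
proof -
  have "(1 + int i * int D) mod int m \<in> cyclotomic_coset m q 1"
    using assms(6) by (subst cyclotomic_coset_eq_progression[OF assms(1) _ assms(2-5)]) auto
  then show ?thesis using that by (auto simp: cyclotomic_coset_def cong_def)
qed

text \<open>If \<open>p\<close> does not divide \<open>D\<close>, then it divides \<open>t\<close>,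
  so the indices below \<open>t\<close> cover all residues modulo \<open>p\<close> and some
  \<open>1 + i * D\<close> is divisible by \<open>p\<close>. This contradicts its being a power of
  \<open>q\<close> modulo \<open>m\<close>.\<close>

lemma prime_dvd_of_ord:
  fixes m q t D p :: nat
  assumes "coprime m q" "m > 0" "t = ord m q" "m = t * D" "int D dvd int q - 1"
    and "prime p" "p dvd m"
  shows "p dvd D"
proof (rule ccontr)
  assume pD: "\<not> p dvd D"
  then have pt: "p dvd t" using assms(4,6,7) prime_dvd_multD by blast
  have "coprime p D"
    using pD assms(6) by (simp add: prime_imp_coprime)
  then have "coprime (int D) (int p)"
    by (simp add: coprime_commute)
  then obtain z where "[int D * z = 1] (mod int p)"
    using cong_solve_coprime_int by blast
  then have "[int D * z * - 1 = 1 * - 1] (mod int p)"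
    by (rule cong_scalar_right)
  then obtain y where y: "[int D * y = - 1] (mod int p)"
    by (metis mult.assoc mult_1)
  define i where "i = nat (y mod int p)"
  have p0: "p > 0" using assms(6) prime_gt_0_nat by blast
  have i: "int i = y mod int p" "i < p" using p0 by (auto simp: i_def nat_less_iff)
  have "t > 0" using assms(2,4) by (cases t) auto
  then have "p \<le> t" using pt by (rule dvd_imp_le[rotated])
  then have "i < t" using i(2) by linarith
  then obtain j where "[int q ^ j = 1 + int i * int D] (mod int m)"
    using power_eq_progression[OF assms(1-5)] by blast
  then have "[int q ^ j = 1 + int i * int D] (mod int p)"
    by (rule cong_dvd_modulus) (use assms(7) in simp)
  also have "[1 + int i * int D = 1 + int D * y] (mod int p)"
  proof -
    have "[int i = y] (mod int p)" by (simp add: i(1) cong_def)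
    then have "[1 + int i * int D = 1 + y * int D] (mod int p)"
      by (intro cong_add cong_mult cong_refl)
    then show ?thesis by (simp only: mult.commute)
  qed
  also have "[1 + int D * y = 1 + - 1] (mod int p)"
    by (intro cong_add y cong_refl)
  finally have "int p dvd int (q ^ j)" by (simp add: cong_0_iff)
  then have "p dvd q ^ j" by (simp only: int_dvd_int_iff)
  then have "p dvd q" using assms(6) prime_dvd_power by blast
  then show False using assms(1,6,7) coprime_common_divisor not_prime_unit by blast
qed

lemma cong_1_mod_4_of_ord:
  fixes m q t D :: nat
  assumes "coprime m q" "m > 0" "t = ord m q" "m = t * D" "int D dvd int q - 1" "8 dvd m"
  shows "4 dvd int q - 1"
proof (cases "4 dvd D")
  case True
  then have "4 dvd int D" by presburger
  then show ?thesis using assms(5) dvd_trans by blast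
next
  case False
  have "2 dvd D"
    by (rule prime_dvd_of_ord[OF assms(1-5)]) (use assms(6) in \<open>simp, presburger\<close>)
  \<comment> \<open>As \<open>D\<close> has a single factor 2, divisibility of \<open>m\<close> by 8
    puts a factor 4 into \<open>t\<close>; hence the index 2 is available.\<close>
  then obtain k where k: "D = 2 * k" "odd k" using False by (auto elim!: dvdE)
  then have "4 dvd t * k" using assms(4,6) by (auto simp: mult_ac)
  moreover have "coprime (2 ^ 2) k" using k by (subst coprime_power_left_iff) simp
  ultimately have "4 dvd t" by (simp add: coprime_dvd_mult_left_iff)
  moreover have "t > 0" using assms(2,4) by (cases t) auto
  ultimately have "2 < t" using dvd_imp_le by fastforce
  then obtain j where "[int q ^ j = 1 + int 2 * int D] (mod int m)"
    using power_eq_progression[OF assms(1-5)] by blast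
  then have j: "[int q ^ j = 1 + int 2 * int D] (mod 8)"
    by (rule cong_dvd_modulus) (use assms(6) in presburger)
  have "odd q" using assms(1,6) by (metis coprime_common_divisor dvd_trans even_numeral odd_one)
  \<comment> \<open>Odd squares are 1 modulo 8, so \<open>q ^ j\<close> is 1 or \<open>q\<close> by
    the parity of \<open>j\<close>. The value 1 would give \<open>4 dvd D\<close>.\<close>
  then have q2: "[int q ^ 2 = 1] (mod 8)"
    using square_mod_8_eq_1_iff[of q] by (metis cong_int_iff of_nat_1 of_nat_numeral of_nat_power)
  show ?thesis
  proof (cases "even j")
    case True
    then obtain h where "j = 2 * h" by auto
    then have "[int q ^ j = 1] (mod 8)" using cong_pow[OF q2, of h] by (simp add: power_mult)
    then have "[1 = 1 + int 2 * int D] (mod 8)" using j cong_trans cong_sym by blast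
    then have False using False by (simp add: cong_iff_dvd_diff) presburger
    then show ?thesis ..
  next
    case False
    then obtain h where "j = 2 * h + 1" by (auto elim: oddE)
    then have "[int q ^ j = int q] (mod 8)"
      using cong_mult[OF cong_refl[of "int q"] cong_pow[OF q2, of h]] by (simp add: power_mult)
    then have "[int q = 1 + int 2 * int D] (mod 8)" using j cong_trans cong_sym by blast
    then show ?thesis using \<open>2 dvd D\<close> unfolding cong_iff_dvd_diff by presburger
  qed
qed

section \<open>Sufficiency: lifting the exponent\<close>

lemma geometric_sum_cong:
  fixes x a :: int
  assumes "[x = 1] (mod a)"
  shows "[(\<Sum>i<n. x ^ i) = int n] (mod a)"
proof -
  have "[(\<Sum>i<n. x ^ i) = (\<Sum>i<n. 1 ^ i)] (mod a)"
    by (intro cong_sum cong_pow assms)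
  then show ?thesis by simp
qed

text \<open>Each further \<open>p\<close>-th power gains a factor \<open>p\<close>: in
  \<open>y ^ p - 1 = (y - 1) * (\<Sum>i<p. y ^ i)\<close> the sum is congruent to \<open>p\<close>,
  hence to 0, modulo \<open>p\<close>.\<close>

lemma power_prime_power_cong_1:
  fixes x :: int
  assumes "[x = 1] (mod int p)"
  shows "[x ^ (p ^ k) = 1] (mod int p ^ Suc k)"
proof (induction k)
  case 0
  then show ?case using assms by simp
next
  case (Suc k)
  define y where "y = x ^ (p ^ k)"
  have y: "[y = 1] (mod int p ^ Suc k)" using Suc by (simp add: y_def)
  then have "[y = 1] (mod int p)" by (rule cong_dvd_modulus) simp
  then have "int p dvd (\<Sum>i<p. y ^ i)"
    using cong_dvd_iff[OF geometric_sum_cong[of y "int p" p]] by simp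
  then have "int p ^ Suc k * int p dvd (y - 1) * (\<Sum>i<p. y ^ i)"
    using y by (intro mult_dvd_mono) (auto simp: cong_iff_dvd_diff)
  also have "\<dots> = y ^ p - 1" by (rule power_diff_1_eq[symmetric])
  finally show ?case
    by (simp add: y_def cong_iff_dvd_diff mult_ac flip: power_mult)
qed

text \<open>Applied to \<open>q\<close>, this shows that the order of \<open>q\<close> modulo
  \<open>m\<close> divides \<open>m\<close>.\<close>

lemma dvd_power_self_minus_1:
  fixes x :: int and m :: nat
  assumes "m > 0" "\<And>p. prime p \<Longrightarrow> p dvd m \<Longrightarrow> int p dvd x - 1"
  shows "int m dvd x ^ m - 1"
proof (rule dvd_if_prime_powers_dvd)
  fix p a :: nat assume p: "prime p" "p ^ a dvd m"
  show "int p ^ a dvd x ^ m - 1"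
  proof (cases "a = 0")
    case False
    then have "p dvd m" using p by (meson dvd_power dvd_trans neq0_conv)
    then have "[x = 1] (mod int p)" using assms p by (simp add: cong_iff_dvd_diff)
    then have "[x ^ (p ^ a) = 1] (mod int p ^ Suc a)" by (rule power_prime_power_cong_1)
    then have *: "[x ^ (p ^ a) = 1] (mod int p ^ a)" by (rule cong_dvd_modulus) simp
    obtain c where "m = p ^ a * c" using p by auto
    then have "[x ^ m = 1] (mod int p ^ a)"
      using cong_pow[OF *, of c] by (simp add: power_mult)
    then show ?thesis by (simp add: cong_iff_dvd_diff)
  qed simp
qed (fact assms)

text \<open>This bounds the gain in passing from \<open>x - 1\<close> to \<open>x ^ p - 1\<close> by
  one factor \<open>p\<close>. For odd \<open>p\<close> the sum is \<open>p\<close> modulo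
  \<open>p ^ 2\<close>; for \<open>p = 2\<close> it is \<open>1 + x\<close>, which is 2 modulo
  4.\<close>

lemma not_square_dvd_geometric_sum:
  fixes x :: int
  assumes "prime p" "int p dvd x - 1" "p = 2 \<Longrightarrow> 4 dvd x - 1"
  shows "\<not> int p ^ 2 dvd (\<Sum>i<p. x ^ i)"
proof (cases "p = 2")
  case True
  have "(\<Sum>i<p. x ^ i) = 1 + x" by (simp add: True lessThan_nat_numeral numeral_2_eq_2)
  then show ?thesis using assms True by simp presburger
next
  case False
  then have odd: "odd p" using assms primes_dvd_imp_eq two_is_prime_nat by blast
  obtain y where y: "x = 1 + int p * y"
    using assms by (metis add.commute diff_add_cancel dvdE)
  \<comment> \<open>The binomial expansion to first order, higher terms vanishing modulo
    \<open>p ^ 2\<close>.\<close>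
  have pow: "[x ^ i = 1 + int i * (int p * y)] (mod int p ^ 2)" for i
  proof (induction i)
    case (Suc i)
    have "[x * x ^ i = x * (1 + int i * (int p * y))] (mod int p ^ 2)"
      by (intro cong_mult cong_refl Suc)
    also have "[x * (1 + int i * (int p * y)) = 1 + int (Suc i) * (int p * y)] (mod int p ^ 2)"
      by (auto simp: cong_iff_dvd_diff y algebra_simps power2_eq_square)
    finally show ?case by simp
  qed simp
  have "[(\<Sum>i<p. x ^ i) = (\<Sum>i<p. 1 + int i * (int p * y))] (mod int p ^ 2)"
    by (intro cong_sum pow)
  also have "(\<Sum>i<p. 1 + int i * (int p * y)) = int p + int (\<Sum>i<p. i) * (int p * y)"
    by (simp add: sum.distrib sum_distrib_right)
  also have "[\<dots> = int p] (mod int p ^ 2)"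
  proof -
    \<comment> \<open>Doubling clears the denominator of \<open>p * (p - 1) / 2\<close>; the factor
      2 then cancels because \<open>p\<close> is odd.\<close>
    have "p dvd 2 * (\<Sum>i<p. i)"
      using odd by (simp add: lessThan_atLeast0 Sum_Ico_nat)
    then have "p dvd (\<Sum>i<p. i)"
      using odd by (simp add: coprime_dvd_mult_right_iff)
    then have "int p dvd int (\<Sum>i<p. i)" by (simp only: int_dvd_int_iff)
    then have "int p * int p dvd int (\<Sum>i<p. i) * (int p * y)"
      by (intro mult_dvd_mono) auto
    then show ?thesis by (simp only: cong_iff_dvd_diff power2_eq_square add_diff_cancel_left')
  qed
  finally have "int p ^ 2 dvd (\<Sum>i<p. x ^ i) \<longleftrightarrow> int p ^ 2 dvd int p"
    by (rule cong_dvd_iff)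
  moreover have "\<not> int p ^ 2 dvd int p"
  proof
    assume "int p ^ 2 dvd int p"
    then have "int p ^ 2 \<le> int p" using assms by (intro zdvd_imp_le) (auto simp: prime_gt_0_nat)
    then show False using prime_gt_1_nat[OF assms(1)] by (simp add: power2_eq_square)
  qed
  ultimately show ?thesis by simp
qed

lemma prime_power_dvd_mult_left:
  fixes p x y :: int
  assumes p: "prime p" and "\<not> p ^ 2 dvd y" "p ^ (b + 1) dvd x * y"
  shows "p ^ b dvd x"
proof (cases "p dvd y")
  case True
  then obtain z where z: "y = p * z" by auto
  then have "\<not> p dvd z" using assms by (auto simp: power2_eq_square)
  then have "coprime (p ^ b) z" using p by (simp add: prime_imp_coprime)
  moreover have "p * p ^ b dvd p * (x * z)" using assms by (simp add: z mult_ac)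
  ultimately show ?thesis
    using p by (simp add: coprime_dvd_mult_left_iff)
next
  case False
  then have "coprime (p ^ (b + 1)) y" using p by (simp add: prime_imp_coprime)
  then have "p ^ (b + 1) dvd x" using assms by (simp add: coprime_dvd_mult_left_iff)
  then show ?thesis by (rule dvd_trans[rotated]) simp
qed

text \<open>Induction strips factors \<open>p\<close> from \<open>t\<close>. Each one accounts for
  at most one factor \<open>p\<close> of \<open>x ^ t - 1\<close>; once \<open>p\<close> does not
  divide \<open>t\<close>, the cofactor of \<open>x - 1\<close> is prime to
  \<open>p\<close>.\<close>

lemma prime_power_dvd_lifting:
  fixes x :: int
  assumes "prime p" "int p dvd x - 1" "p = 2 \<Longrightarrow> 4 dvd x - 1" "t > 0"
    and "int p ^ a dvd x ^ t - 1"
  shows "int p ^ a dvd int t * (x - 1)"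
  using assms(4,5)
proof (induction t arbitrary: a rule: less_induct)
  case (less t)
  have p: "prime (int p)" using assms by simp
  show ?case
  proof (cases "p dvd t")
    case False
    have "[(\<Sum>i<t. x ^ i) = int t] (mod int p)"
      using assms by (intro geometric_sum_cong) (simp add: cong_iff_dvd_diff)
    then have "\<not> int p dvd (\<Sum>i<t. x ^ i)"
      using False by (simp add: cong_dvd_iff)
    then have "coprime (int p ^ a) (\<Sum>i<t. x ^ i)"
      using p by (simp add: prime_imp_coprime)
    moreover have "int p ^ a dvd (x - 1) * (\<Sum>i<t. x ^ i)"
      using less by (simp add: power_diff_1_eq)
    ultimately show ?thesis
      by (simp add: coprime_dvd_mult_left_iff)
  next
    case True
    then obtain s where s: "t = p * s" by auto
    show ?thesis
    proof (cases a)
      case (Suc b)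
      define y where "y = x ^ s"
      \<comment> \<open>Through this divisibility \<open>y\<close> inherits the hypotheses on
        \<open>x\<close>, including the one modulo 4.\<close>
      have xy: "x - 1 dvd y - 1" by (simp add: y_def power_diff_1_eq)
      have "int p ^ 2 dvd (\<Sum>i<p. y ^ i) \<Longrightarrow> False"
        using not_square_dvd_geometric_sum[of p y] assms xy dvd_trans by metis
      moreover have "int p ^ (b + 1) dvd (y - 1) * (\<Sum>i<p. y ^ i)"
        unfolding power_diff_1_eq[symmetric]
        using less(3) by (simp add: Suc y_def s mult.commute flip: power_mult)
      ultimately have "int p ^ b dvd y - 1"
        using prime_power_dvd_mult_left[OF p] by blast
      moreover have "s > 0" "s < t" using less s prime_gt_1_nat[OF assms(1)] by auto
      ultimately have "int p ^ b dvd int s * (x - 1)"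
        using less by (simp add: y_def)
      then show ?thesis by (simp add: s Suc mult.assoc)
    qed simp
  qed
qed

text \<open>Lifting the exponent covers every prime except 2 when \<open>q\<close> is 3 modulo 4.
  There \<open>8\<close> does not divide \<open>m\<close>, so only the exponents 1 and 2 need
  checking by hand.\<close>

lemma dvd_ord_mult:
  fixes m q :: nat
  assumes "m > 0" "coprime m q"
    and pr: "\<And>p. prime p \<Longrightarrow> p dvd m \<Longrightarrow> int p dvd int q - 1"
    and 8: "8 dvd m \<Longrightarrow> 4 dvd int q - 1"
  shows "int m dvd int (ord m q) * (int q - 1)"
proof (rule dvd_if_prime_powers_dvd)
  define t where "t = ord m q"
  have t: "t > 0" using assms by (simp add: t_def coprime_commute)
  have "[q ^ t = 1] (mod m)" unfolding t_def by (rule ord)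
  then have "[int (q ^ t) = int 1] (mod int m)" by (subst cong_int_iff)
  then have m: "int m dvd int q ^ t - 1" by (simp add: cong_iff_dvd_diff)
  fix p a :: nat assume p: "prime p" "p ^ a dvd m"
  have "int (p ^ a) dvd int q ^ t - 1"
    using p m by (meson dvd_trans int_dvd_int_iff)
  then have pa: "int p ^ a dvd int q ^ t - 1" by simp
  show "int p ^ a dvd int (ord m q) * (int q - 1)"
    unfolding t_def[symmetric]
  proof (cases "a = 0")
    case False
    then have "p dvd m" using p by (meson dvd_power dvd_trans neq0_conv)
    then have pq: "int p dvd int q - 1" using pr p by simp
    show "int p ^ a dvd int t * (int q - 1)"
    proof (cases "p = 2 \<longrightarrow> 4 dvd int q - 1")
      case True
      then show ?thesis using prime_power_dvd_lifting p pq pa t by blast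
    next
      case F: False
      then have "\<not> 2 ^ 3 dvd m" using 8 by auto
      then have "\<not> 3 \<le> a" using p F dvd_trans[OF le_imp_power_dvd[of 3 a p] p(2)] by auto
      then have "a = 1 \<or> a = 2" using False by linarith
      then show ?thesis
      proof
        assume a: "a = 2"
        \<comment> \<open>Here \<open>q\<close> is -1 modulo 4, and an odd power of it could not be
          1; so \<open>t\<close> and \<open>q - 1\<close> each contribute a factor 2.\<close>
        have "even t"
        proof (rule ccontr)
          assume "odd t"
          then obtain h where h: "t = 2 * h + 1" by (auto elim: oddE)
          have "[int q = -1] (mod 4)"
            using F pq unfolding cong_iff_dvd_diff by simp presburger
          then have "[int q ^ t = (-1) ^ t] (mod 4)" by (rule cong_pow)
          then have "4 dvd int q ^ t + 1"
            using h by (simp add: cong_iff_dvd_diff)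
          moreover have "4 dvd int q ^ t - 1" using pa a F by simp
          ultimately show False by presburger
        qed
        then have "2 * 2 dvd int t * (int q - 1)"
          using pq F by (intro mult_dvd_mono) auto
        then show ?thesis using a F by simp
      qed (use pq in simp)
    qed
  qed simp
qed (fact assms)

theorem theorem3p1:
  fixes q n :: nat and \<gamma> :: int
  assumes "primepow q" and "n > 0" and "coprime n q"
  shows "equal_difference n q \<gamma> \<longleftrightarrow>
    rad (reduced_modulus n \<gamma>) dvd q - 1 \<and>
    (8 dvd reduced_modulus n \<gamma> \<longrightarrow> [q = 1] (mod 4))"
proof -
  define d where "d = nat (gcd \<gamma> (int n))"
  define m where "m = reduced_modulus n \<gamma>"
  define t where "t = ord m q"
  have d0: "d > 0" and d: "int d = gcd \<gamma> (int n)" using assms by (auto simp: d_def)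
  have n: "n = d * m"
    unfolding m_def reduced_modulus_def d_def[symmetric] using d
    by (metis dvd_mult_div_cancel gcd_dvd2 int_dvd_int_iff)
  define g where "g = \<gamma> div int d"
  have \<gamma>: "\<gamma> = int d * g" unfolding g_def d by simp
  have m0: "m > 0" using assms n by simp
  have cop: "coprime m q" using assms n by simp
  have gm: "coprime g (int m)"
  proof -
    \<comment> \<open>Both sides are the gcd of \<gamma> and \<open>n\<close>, with \<open>d\<close>
      pulled out on the left.\<close>
    have "int d * gcd g (int m) = int d * 1"
      using d unfolding n by (simp add: \<gamma> gcd_mult_left)
    then show ?thesis using d0 by (simp add: coprime_iff_gcd_eq_1)
  qed
  have q0: "q > 0" using assms by (simp add: primepow_gt_0_nat)
  \<comment> \<open>Positivity of \<open>q\<close> makes the truncated \<open>q - 1\<close> of the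
    statement agree with the integer difference.\<close>
  have int_q: "int k dvd int q - 1 \<longleftrightarrow> k dvd q - 1" for k
    using q0 by (metis One_nat_def Suc_leI int_dvd_int_iff of_nat_1 of_nat_diff)
  have q4: "[q = 1] (mod 4) \<longleftrightarrow> 4 dvd int q - 1"
    by (metis cong_iff_dvd_diff cong_int_iff of_nat_1 of_nat_numeral)
  have t0: "t > 0" using cop by (simp add: t_def coprime_commute)
  have "equal_difference n q \<gamma> \<longleftrightarrow> t dvd m \<and> int (m div t) dvd int q - 1"
    unfolding n \<gamma> t_def using cop gm m0 d0 by (rule equal_difference_iff_ord)
  also have "\<dots> \<longleftrightarrow> rad m dvd q - 1 \<and> (8 dvd m \<longrightarrow> [q = 1] (mod 4))"
  proof
    assume L: "t dvd m \<and> int (m div t) dvd int q - 1"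
    then have mt: "m = t * (m div t)" by simp
    note * = cop m0 t_def mt conjunct2[OF L]
    have "rad m dvd m div t"
      by (intro rad_dvdI prime_dvd_of_ord[OF *])
    then have "rad m dvd q - 1" using L int_q dvd_trans by blast
    then show "rad m dvd q - 1 \<and> (8 dvd m \<longrightarrow> [q = 1] (mod 4))"
      using cong_1_mod_4_of_ord[OF *] q4 by blast
  next
    assume R: "rad m dvd q - 1 \<and> (8 dvd m \<longrightarrow> [q = 1] (mod 4))"
    have pr: "int p dvd int q - 1" if "prime p" "p dvd m" for p
      unfolding int_q using that R m0 prime_dvd_rad dvd_trans by blast
    have "int m dvd int q ^ m - 1" by (rule dvd_power_self_minus_1[OF m0 pr])
    then have "[int (q ^ m) = int 1] (mod int m)" by (simp add: cong_iff_dvd_diff)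
    then have "[q ^ m = 1] (mod m)" by (simp only: cong_int_iff)
    then have tm: "t dvd m" unfolding t_def by (simp only: ord_divides)
    have "int m dvd int t * (int q - 1)"
      unfolding t_def using R q4 by (intro dvd_ord_mult m0 cop pr) auto
    \<comment> \<open>Writing \<open>m\<close> as \<open>t * (m div t)\<close> lets the positive
      factor \<open>t\<close> cancel.\<close>
    then have "int t * int (m div t) dvd int t * (int q - 1)"
      using tm by (metis dvd_mult_div_cancel of_nat_mult)
    then show "t dvd m \<and> int (m div t) dvd int q - 1"
      using tm t0 by simp
  qed
  finally show ?thesis unfolding m_def .
qed

end
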